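(* Let $\mu$ be a Lamperti stable distribution on $\mathbb{R}$. Then $\mu$ has a $C^\infty$ density and all the derivatives of the density tend to $0$ as $|x|\to\infty$.
   Context: An infinitely divisible probability measure $\mu$ on $\mathbb{R}$ without Gaussian component is called Lamperti stable if its Lévy measure on $\mathbb{R}\setminus\{0\}$ is $$\nu^{\alpha,f}_\sigma(dx)=\Big(\frac{c_+e^{\beta x}}{(e^x-1)^{\alpha+1}}1_{\{x>0\}}+\frac{c_-e^{-\rho x}}{(e^{-x}-1)^{\alpha+1}}1_{\{x<0\}}\Big)dx,$$ where $\alpha\in(0,2)$, $c_+=\sigma(\{1\})\ge0$ and $c_-=\sigma(\{-1\})\ge0$ for a non-zero finite measure $\sigma$ on $S^0=\{-1,1\}$ (so $c_++c_->0$), and $\beta=f(1)$, $\rho=f(-1)$ for a function $f:S^0\to\mathbb{R}$ with $\max(\beta,\rho)<\alpha+1$. *)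

theory Defs
  imports "HOL-Probability.Probability"
begin

definition infinitely_divisible :: "real measure \<Rightarrow> bool" where
  "infinitely_divisible \<mu> \<longleftrightarrow> real_distribution \<mu> \<and>
     (\<forall>n\<ge>1. \<exists>\<mu>'. real_distribution \<mu>' \<and> ((\<lambda>M. \<mu>' \<star> M) ^^ n) (return borel 0) = \<mu>)"

definition levy_measure :: "real measure \<Rightarrow> bool" where
  "levy_measure \<nu> \<longleftrightarrow> sets \<nu> = sets borel \<and> emeasure \<nu> {0} = 0 \<and>
     (\<integral>\<^sup>+x. ennreal (min 1 (x\<^sup>2)) \<partial>\<nu>) < \<infinity>"

text \<open>Levy--Khintchine representation with Gaussian variance \<open>a\<close>, Levy measure \<open>\<nu>\<close>, and drift
  \<open>b\<close> relative to the truncation function \<open>x \<mapsto> x 1\<^bsub>{|x| \<le> 1}\<^esub>\<close>. Another choice of truncation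
  function would change \<open>b\<close> only.\<close>

definition levy_exponent :: "real \<Rightarrow> real \<Rightarrow> real measure \<Rightarrow> real \<Rightarrow> complex" where
  "levy_exponent a b \<nu> t =
     - complex_of_real (a * t\<^sup>2 / 2) + \<i> * complex_of_real (b * t) +
     (CLINT x|\<nu>. iexp (t * x) - 1 - \<i> * complex_of_real (t * x * indicator {-1..1} x))"

definition has_levy_triplet :: "real measure \<Rightarrow> real \<Rightarrow> real \<Rightarrow> real measure \<Rightarrow> bool" where
  "has_levy_triplet \<mu> a b \<nu> \<longleftrightarrow> infinitely_divisible \<mu> \<and> 0 \<le> a \<and> levy_measure \<nu> \<and>
     (\<forall>t. char \<mu> t = exp (levy_exponent a b \<nu> t))"

definition lamperti_levy_density :: "real \<Rightarrow> real measure \<Rightarrow> (real \<Rightarrow> real) \<Rightarrow> real \<Rightarrow> real" where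
  "lamperti_levy_density \<alpha> \<sigma> f x =
     (if x > 0 then measure \<sigma> {1} * exp (f 1 * x) / (exp x - 1) powr (\<alpha> + 1)
      else if x < 0 then measure \<sigma> {-1} * exp (- f (-1) * x) / (exp (-x) - 1) powr (\<alpha> + 1)
      else 0)"

text \<open>The Levy measure lives on \<open>\<real> - {0}\<close>; it is represented as a measure on \<open>\<real>\<close> without mass at \<open>0\<close>.\<close>

definition lamperti_levy_measure :: "real \<Rightarrow> real measure \<Rightarrow> (real \<Rightarrow> real) \<Rightarrow> real measure" where
  "lamperti_levy_measure \<alpha> \<sigma> f = density lborel (\<lambda>x. ennreal (lamperti_levy_density \<alpha> \<sigma> f x))"

text \<open>Only the values of \<open>f\<close> on the sphere \<open>{-1, 1}\<close> are used.\<close>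

definition lamperti_stable :: "real measure \<Rightarrow> bool" where
  "lamperti_stable \<mu> \<longleftrightarrow>
     (\<exists>\<alpha> \<sigma> f b. 0 < \<alpha> \<and> \<alpha> < 2 \<and>
        finite_measure \<sigma> \<and> space \<sigma> = {-1, 1} \<and> sets \<sigma> = Pow {-1, 1} \<and> emeasure \<sigma> {-1, 1} \<noteq> 0 \<and>
        max (f 1) (f (-1)) < \<alpha> + 1 \<and>
        has_levy_triplet \<mu> 0 b (lamperti_levy_measure \<alpha> \<sigma> f))"

definition smooth_real :: "(real \<Rightarrow> real) \<Rightarrow> bool" where
  "smooth_real g \<longleftrightarrow> (\<forall>k x. ((deriv ^^ k) g) differentiable (at x))"

end

theory Submission imports Defs begin

text \<open>
The characteristic function of \<open>\<mu>\<close> decays at least as fast as \<open>exp (- K * \<bar>t\<bar> powr \<alpha>)\<close>, and a measure whose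
characteristic function decreases faster than every power has a smooth density whose derivatives all
vanish at infinity.

The decay comes from the small jumps. The modulus of the characteristic function is
\<open>exp (- \<integral>x. 1 - cos (t * x) \<partial>\<nu>)\<close> with \<open>\<nu>\<close> the Levy measure, and near the origin the Lamperti density is
bounded below on at least one side by a multiple of \<open>\<bar>x\<bar> powr - (\<alpha> + 1)\<close>
(\<open>lamperti_profile_ge\<close>). Only jumps with \<open>1 / 2 \<le> \<bar>t * x\<bar> \<le> 1\<close> have to be counted: on this window
\<open>1 - cos (t * x)\<close> is bounded away from \<open>0\<close>, and its \<open>\<nu>\<close>-mass is at least of order \<open>\<bar>t\<bar> powr \<alpha>\<close>
(\<open>integral_one_minus_cos_ge_powr\<close>, \<open>char_lamperti_stable_le\<close>).

For the passage to the density, Levy's inversion theorem expresses increments of the distribution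
function through the characteristic function. When the latter is integrable, the resulting expression
can be differentiated under the integral, so the distribution function is differentiable
(\<open>has_real_derivative_cdf\<close>) and its derivative, the inverse Fourier integral of the characteristic
function, is a density (\<open>eq_density_inverse_fourier_char\<close>). Further derivatives again fall under the
integral (\<open>deriv_funpow_fourier\<close>), and each of them is the Fourier integral of a continuous function of
quadratic decay, which tends to \<open>0\<close> by the Riemann--Lebesgue lemma (\<open>fourier_tendsto_zero\<close>).
\<close>

section \<open>Fourier integrals\<close>

text \<open>By the mean value inequality the difference quotients of \<open>\<lambda>x. f x t\<close>, after subtraction of the
derivative at the point in question, stay below \<open>2 * w t\<close>, so dominated convergence applies.
The pointwise hypotheses are required for almost every \<open>t\<close> only, since the inversion kernel treated
below is a quotient by \<open>t\<close>.\<close>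

lemma has_vector_derivative_integral_param:
  fixes f f' :: "real \<Rightarrow> 'a \<Rightarrow> 'b :: {banach, second_countable_topology}"
  assumes int: "\<And>x. integrable M (f x)"
    and deriv: "AE t in M. \<forall>x. ((\<lambda>x. f x t) has_vector_derivative f' x t) (at x)"
    and bound: "AE t in M. \<forall>x. norm (f' x t) \<le> w t"
    and meas [measurable]: "\<And>x. f' x \<in> borel_measurable M"
    and w: "integrable M w"
  shows "((\<lambda>x. \<integral>t. f x t \<partial>M) has_vector_derivative (\<integral>t. f' x t \<partial>M)) (at x)"
proof -
  \<comment> \<open>the error of the linear approximation at \<open>x\<close>, relative to the increment \<open>h\<close>\<close>
  define q where "q h t = (1 / h) *\<^sub>R (f (x + h) t - f x t - h *\<^sub>R f' x t)" for h t
  have int': "integrable M (f' x)"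
    by (rule Bochner_Integration.integrable_bound[OF w])
      (use bound in \<open>auto elim!: eventually_mono intro: order_trans[OF _ abs_ge_self]\<close>)
  have q_le: "AE t in M. norm (q h t) \<le> 2 * w t" if "h \<noteq> 0" for h
    using deriv bound
  proof eventually_elim
    case (elim t)
    have "norm (f (x + h) t - f x t - ((x + h) - x) *\<^sub>R f' x t) \<le> norm ((x + h) - x) * (2 * w t)"
    proof (rule vector_differentiable_bound_linearization[where S = UNIV])
      show "norm (f' y t - f' x t) \<le> 2 * w t" for y
        using elim(2) norm_triangle_ineq4[of "f' y t" "f' x t"] by (smt (verit))
    qed (use elim in auto)
    then show ?case
      using that by (simp add: q_def divide_le_eq mult.commute)
  qed
  have q_lim: "AE t in M. ((\<lambda>h. q h t) \<longlongrightarrow> 0) (at 0)"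
    using deriv
  proof eventually_elim
    case (elim t)
    then have "((\<lambda>h. norm (f (x + h) t - f x t - h *\<^sub>R f' x t) / norm h) \<longlongrightarrow> 0) (at 0)"
      by (auto simp: has_vector_derivative_def has_derivative_at)
    then show ?case
      by (subst tendsto_norm_zero_iff[symmetric]) (simp add: q_def divide_inverse mult.commute)
  qed
  have "((\<lambda>h. \<integral>t. q h t \<partial>M) \<longlongrightarrow> 0) (at 0)"
    unfolding tendsto_at_iff_sequentially
  proof (intro allI impI)
    fix X :: "nat \<Rightarrow> real" assume X: "\<forall>i. X i \<in> UNIV - {0}" "X \<longlonglongrightarrow> 0"
    have "(\<lambda>i. \<integral>t. q (X i) t \<partial>M) \<longlonglongrightarrow> (\<integral>t. 0 \<partial>M)"
    proof (rule integral_dominated_convergence[where w = "\<lambda>t. 2 * w t"])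
      show "AE t in M. (\<lambda>i. q (X i) t) \<longlonglongrightarrow> 0"
        using q_lim by eventually_elim (use X in \<open>auto simp: tendsto_at_iff_sequentially comp_def\<close>)
      show "AE t in M. norm (q (X i) t) \<le> 2 * w t" for i
        using q_le[of "X i"] X by auto
      show "q (X i) \<in> borel_measurable M" for i
        using int[THEN borel_measurable_integrable] meas unfolding q_def by measurable
    qed (use w in auto)
    then show "((\<lambda>h. \<integral>t. q h t \<partial>M) \<circ> X) \<longlonglongrightarrow> 0"
      by (simp add: comp_def)
  qed
  moreover have "(\<integral>t. q h t \<partial>M)
      = (1 / h) *\<^sub>R ((\<integral>t. f (x + h) t \<partial>M) - (\<integral>t. f x t \<partial>M) - h *\<^sub>R (\<integral>t. f' x t \<partial>M))" for h
    using int int' by (simp add: q_def)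
  ultimately have "((\<lambda>h. norm ((\<integral>t. f (x + h) t \<partial>M) - (\<integral>t. f x t \<partial>M) - h *\<^sub>R (\<integral>t. f' x t \<partial>M)) / norm h)
      \<longlongrightarrow> 0) (at 0)"
    by (subst (asm) tendsto_norm_zero_iff[symmetric]) (simp add: divide_inverse mult.commute)
  then show ?thesis
    by (auto simp: has_vector_derivative_def has_derivative_at bounded_linear_scaleR_left)
qed

lemma integrable_inverse_one_plus_square: "integrable lborel (\<lambda>t::real. C / (1 + t\<^sup>2))"
proof -
  have "integrable lborel (\<lambda>t::real. inverse (1 + t\<^sup>2))"
    using integrable_inverse_1_plus_square by (simp add: set_integrable_def)
  then show ?thesis by (simp add: divide_inverse)
qed

lemma integrable_if_quadratic_decay:
  fixes h :: "real \<Rightarrow> complex"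
  assumes "h \<in> borel_measurable borel" "\<And>t. norm (h t) \<le> C / (1 + t\<^sup>2)"
  shows "integrable lborel h"
proof (rule Bochner_Integration.integrable_bound[OF integrable_inverse_one_plus_square[of C]])
  show "AE t in lborel. norm (h t) \<le> norm (C / (1 + t\<^sup>2))"
    using order_trans[OF assms(2) abs_ge_self] by (intro AE_I2) simp
qed (use assms in simp)

text \<open>The sign in the exponent is opposite to that of a characteristic function, and there is no factor
\<open>1 / (2 * pi)\<close>: up to that factor this is the transform that inverts \<^const>\<open>char\<close>.\<close>

definition fourier :: "(real \<Rightarrow> complex) \<Rightarrow> real \<Rightarrow> complex" where
  "fourier h x = (CLINT t|lborel. iexp (- (t * x)) * h t)"

lemma has_vector_derivative_fourier:
  assumes meas [measurable]: "h \<in> borel_measurable borel"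
    and h: "integrable lborel h" and th: "integrable lborel (\<lambda>t. t * h t)"
  shows "(fourier h has_vector_derivative fourier (\<lambda>t. - \<i> * t * h t) x) (at x)"
  unfolding fourier_def
proof (rule has_vector_derivative_integral_param[where w = "\<lambda>t. norm (t * h t)"])
  show "integrable lborel (\<lambda>t. iexp (- (t * x)) * h t)" for x
    by (rule Bochner_Integration.integrable_bound[OF h]) (auto simp: norm_mult)
  show "AE t in lborel. \<forall>x. ((\<lambda>x. iexp (- (t * x)) * h t) has_vector_derivative
      iexp (- (t * x)) * (- \<i> * t * h t)) (at x)"
    unfolding has_vector_derivative_complex_iff
    by (intro AE_I2 allI conjI) (auto simp: Re_exp Im_exp algebra_simps intro!: derivative_eq_intros)
  show "integrable lborel (\<lambda>t. norm (t * h t))"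
    using th by (rule integrable_norm)
qed (auto simp: norm_mult)

text \<open>This is continuity of translation in \<open>L\<^sup>1\<close>. Quadratic decay survives translation by at most \<open>1\<close>
with three times the constant, which gives one dominating function for all small shifts.\<close>

lemma tendsto_integral_translation_diff:
  fixes h :: "real \<Rightarrow> complex"
  assumes cont: "continuous_on UNIV h" and decay: "\<And>t. norm (h t) \<le> C / (1 + t\<^sup>2)"
  shows "((\<lambda>s. LINT t|lborel. norm (h t - h (t + s))) \<longlongrightarrow> 0) (at 0)"
  unfolding tendsto_at_iff_sequentially
proof (intro allI impI)
  have [measurable]: "h \<in> borel_measurable borel"
    using cont by (rule borel_measurable_continuous_onI)
  have C: "0 \<le> C" using order_trans[OF norm_ge_zero decay[of 0]] by simp
  have shift: "norm (h (t + s)) \<le> 3 * C / (1 + t\<^sup>2)" if "\<bar>s\<bar> \<le> 1" for t s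
  proof -
    have "s\<^sup>2 \<le> 1" using that by (simp add: abs_square_le_1)
    \<comment> \<open>\<open>t\<^sup>2 \<le> 2 * (t + s)\<^sup>2 + 2 * s\<^sup>2\<close>, because the difference of the two sides is \<open>(t + 2 * s)\<^sup>2\<close>\<close>
    moreover have "0 \<le> (t + 2 * s)\<^sup>2" "0 \<le> (t + s)\<^sup>2" by auto
    ultimately have "1 + t\<^sup>2 \<le> 3 * (1 + (t + s)\<^sup>2)"
      by (simp add: power2_eq_square algebra_simps)
    then have "C / (1 + (t + s)\<^sup>2) \<le> 3 * C / (1 + t\<^sup>2)"
      using mult_left_mono[OF _ C, of "1 + t\<^sup>2" "3 * (1 + (t + s)\<^sup>2)"] 
      by (simp add: divide_simps add_pos_nonneg algebra_simps)
    then show ?thesis using decay[of "t + s"] by linarith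
  qed
  fix X :: "nat \<Rightarrow> real" assume X: "\<forall>i. X i \<in> UNIV - {0}" "X \<longlonglongrightarrow> 0"
  obtain N where N: "\<And>n. n \<ge> N \<Longrightarrow> \<bar>X n\<bar> \<le> 1"
    using LIMSEQ_D[OF X(2), of 1] by fastforce
  have "(\<lambda>i. LINT t|lborel. norm (h t - h (t + X (i + N)))) \<longlonglongrightarrow> (LINT t|(lborel::real measure). 0)"
  proof (rule integral_dominated_convergence[where w = "\<lambda>t. 4 * C / (1 + t\<^sup>2)"])
    show "AE t in lborel. (\<lambda>i. norm (h t - h (t + X (i + N)))) \<longlonglongrightarrow> 0"
    proof (rule AE_I2)
      fix t
      have "(\<lambda>i. t + X (i + N)) \<longlonglongrightarrow> t + 0"
        by (intro tendsto_intros LIMSEQ_ignore_initial_segment X)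
      then have "(\<lambda>i. h (t + X (i + N))) \<longlonglongrightarrow> h t"
        using cont by (auto simp: continuous_on_eq_continuous_at intro: isCont_tendsto_compose)
      then have "(\<lambda>i. norm (h t - h (t + X (i + N)))) \<longlonglongrightarrow> norm (h t - h t)"
        by (intro tendsto_intros)
      then show "(\<lambda>i. norm (h t - h (t + X (i + N)))) \<longlonglongrightarrow> 0" by simp
    qed
    show "AE t in lborel. norm (norm (h t - h (t + X (i + N)))) \<le> 4 * C / (1 + t\<^sup>2)" for i
    proof (rule AE_I2)
      fix t
      have "norm (h t - h (t + X (i + N))) \<le> C / (1 + t\<^sup>2) + 3 * C / (1 + t\<^sup>2)"
        by (intro order_trans[OF norm_triangle_ineq4] add_mono decay shift N) simp
      then show "norm (norm (h t - h (t + X (i + N)))) \<le> 4 * C / (1 + t\<^sup>2)"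
        by (simp add: add_divide_distrib[symmetric])
    qed
  qed (auto intro: integrable_inverse_one_plus_square)
  then show "((\<lambda>s. LINT t|lborel. norm (h t - h (t + s))) \<circ> X) \<longlonglongrightarrow> 0"
    unfolding comp_def by - (rule LIMSEQ_offset[where k = N], simp)
qed

text \<open>The Riemann--Lebesgue lemma. Translating the variable of integration by half a period \<open>pi / x\<close> of
the oscillating factor reverses its sign, so twice the transform is the integral of the oscillating
factor against \<open>h t - h (t + pi / x)\<close>, which vanishes in \<open>L\<^sup>1\<close> as the period shrinks.\<close>

lemma fourier_tendsto_zero:
  assumes cont: "continuous_on UNIV h" and decay: "\<And>t. norm (h t) \<le> C / (1 + t\<^sup>2)"
  shows "(fourier h \<longlongrightarrow> 0) at_infinity"
proof -
  have [measurable]: "h \<in> borel_measurable borel"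
    using cont by (rule borel_measurable_continuous_onI)
  have int: "integrable lborel h"
    by (rule integrable_if_quadratic_decay[OF _ decay]) simp
  have int_shift: "integrable lborel (\<lambda>t. h (t + s))" for s
    using lborel_integrable_real_affine[OF int, of 1 s] by (simp add: add.commute)
  have int_exp: "integrable lborel (\<lambda>t. iexp (- (t * x)) * g t)" if "integrable lborel g" for g x
  proof -
    have [measurable]: "g \<in> borel_measurable borel" using that by auto
    show ?thesis
      by (rule Bochner_Integration.integrable_bound[OF that]) (auto simp: norm_mult)
  qed
  have le: "norm (fourier h x) \<le> (LINT t|lborel. norm (h t - h (t + pi / x))) / 2" if "x \<noteq> 0" for x
  proof -
    let ?s = "pi / x"
    have "iexp (- ((t + ?s) * x)) = - iexp (- (t * x))" for t
    proof -
      have "(t + ?s) * x = t * x + pi" using that by (simp add: field_simps)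
      then show ?thesis by (simp add: complex_eq_iff Re_exp Im_exp)
    qed
    then have "fourier h x = (CLINT t|lborel. - (iexp (- (t * x)) * h (t + ?s)))"
      using lborel_integral_real_affine[of 1 "\<lambda>t. iexp (- (t * x)) * h t" ?s]
      by (simp add: fourier_def add.commute del: of_real_mult of_real_minus mult_minus_right)
    then have "2 * fourier h x
        = fourier h x + - (CLINT t|lborel. iexp (- (t * x)) * h (t + ?s))"
      by simp
    also have "\<dots> = (CLINT t|lborel. iexp (- (t * x)) * h t - iexp (- (t * x)) * h (t + ?s))"
      unfolding fourier_def
      by (subst Bochner_Integration.integral_diff[OF int_exp[OF int] int_exp[OF int_shift]]) simp
    also have "\<dots> = (CLINT t|lborel. iexp (- (t * x)) * (h t - h (t + ?s)))"
      by (simp add: algebra_simps)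
    finally have "norm (2 * fourier h x) \<le> (LINT t|lborel. norm (iexp (- (t * x)) * (h t - h (t + ?s))))"
      by (metis integral_norm_bound)
    then show ?thesis by (simp add: norm_mult)
  qed
  have "((\<lambda>x::real. LINT t|lborel. norm (h t - h (t + pi / x))) \<longlongrightarrow> 0) at_infinity"
  proof (rule filterlim_compose[OF tendsto_integral_translation_diff[OF cont decay]])
    have "((\<lambda>x::real. pi / x) \<longlongrightarrow> 0) at_infinity"
      by (intro tendsto_divide_0[OF tendsto_const] filterlim_ident)
    moreover have "eventually (\<lambda>x::real. pi / x \<noteq> 0) at_infinity"
      using eventually_not_equal_at_infinity[of 0] by eventually_elim simp
    ultimately show "filterlim (\<lambda>x::real. pi / x) (at 0) at_infinity"
      by (simp add: filterlim_at)
  qed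
  then have lim: "((\<lambda>x::real. (LINT t|lborel. norm (h t - h (t + pi / x))) / 2) \<longlongrightarrow> 0) at_infinity"
    by (auto intro: tendsto_eq_intros)
  show ?thesis
    by (rule Lim_null_comparison[OF _ lim])
       (use eventually_not_equal_at_infinity[of 0] le in \<open>auto elim!: eventually_mono\<close>)
qed

text \<open>Each derivative of the transform costs a factor \<open>- \<i> * t\<close> in the integrand, so moments of \<open>h\<close> of
all orders give derivatives of all orders.\<close>

lemma deriv_funpow_fourier:
  fixes h :: "real \<Rightarrow> complex" and c :: real
  assumes meas [measurable]: "h \<in> borel_measurable borel"
    and int: "\<And>k. integrable lborel (\<lambda>t. (- \<i> * t) ^ k * h t)"
  shows "((deriv ^^ k) (\<lambda>x. c * Re (fourier h x))
          = (\<lambda>x. c * Re (fourier (\<lambda>t. (- \<i> * t) ^ k * h t) x)))"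
    and "((\<lambda>x. c * Re (fourier (\<lambda>t. (- \<i> * t) ^ k * h t) x)) has_real_derivative
          c * Re (fourier (\<lambda>t. (- \<i> * t) ^ Suc k * h t) x)) (at x)"
proof -
  show *: "((\<lambda>x. c * Re (fourier (\<lambda>t. (- \<i> * t) ^ k * h t) x)) has_real_derivative
      c * Re (fourier (\<lambda>t. (- \<i> * t) ^ Suc k * h t) x)) (at x)" for k x
  proof -
    have "integrable lborel (\<lambda>t. \<i> * ((- \<i> * t) ^ Suc k * h t))"
      using int[of "Suc k"] by (rule integrable_mult_right)
    then have "(fourier (\<lambda>t. (- \<i> * t) ^ k * h t) has_vector_derivative
        fourier (\<lambda>t. - \<i> * t * ((- \<i> * t) ^ k * h t)) x) (at x)"
      by (intro has_vector_derivative_fourier int) (simp_all add: mult.assoc[symmetric])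
    then show ?thesis
      by (auto simp: has_vector_derivative_complex_iff mult.assoc intro!: DERIV_cmult)
  qed
  show "(deriv ^^ k) (\<lambda>x. c * Re (fourier h x))
      = (\<lambda>x. c * Re (fourier (\<lambda>t. (- \<i> * t) ^ k * h t) x))"
  proof (induction k)
    case (Suc k)
    then show ?case using *[of k] by (auto intro!: ext DERIV_imp_deriv)
  qed simp
qed

section \<open>Fourier inversion for integrable characteristic functions\<close>

lemma iexp_difference_quotient_bound:
  "cmod ((iexp (- (t * a)) - iexp (- (t * b))) / (\<i> * t)) \<le> \<bar>b - a\<bar>"
proof (cases "t = 0")
  case False
  have *: "cmod ((iexp (- (t * a)) - iexp (- (t * b))) / (\<i> * t)) \<le> b - a" if "a \<le> b" for a b
    using Levy_Inversion_aux2[OF that, of "- t"] False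
    by (simp add: norm_divide norm_mult norm_minus_commute)
  show ?thesis
  proof (cases "a \<le> b")
    case True
    then show ?thesis using *[of a b] by simp
  next
    case False
    then show ?thesis using *[of b a] by (simp add: norm_divide norm_minus_commute)
  qed
qed simp

context real_distribution begin

text \<open>A primitive of \<^term>\<open>fourier (char M)\<close>: the integrand is the integral of \<open>iexp (- (t * y)) * char M t\<close>
over \<open>y\<close> from \<open>0\<close> to \<open>x\<close> (except at \<open>t = 0\<close>, where the quotient is \<open>0\<close>). Starting at \<open>0\<close> keeps the kernel
bounded as \<open>t\<close> tends to \<open>0\<close>.\<close>

definition inversion_integral :: "real \<Rightarrow> complex" where
  "inversion_integral x = (CLINT t|lborel. (1 - iexp (- (t * x))) / (\<i> * t) * char M t)"

context
  assumes int_char: "integrable lborel (char M)"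
begin

lemma integrable_inversion_kernel:
  "integrable lborel (\<lambda>t. (iexp (- (t * a)) - iexp (- (t * b))) / (\<i> * t) * char M t)"
proof (rule Bochner_Integration.integrable_bound)
  show "integrable lborel (\<lambda>t. \<bar>b - a\<bar> * norm (char M t))"
    using int_char by simp
  show "AE t in lborel. norm ((iexp (- (t * a)) - iexp (- (t * b))) / (\<i> * t) * char M t)
      \<le> norm (\<bar>b - a\<bar> * norm (char M t))"
    using mult_right_mono[OF iexp_difference_quotient_bound norm_ge_zero]
    by (intro AE_I2) (simp add: norm_mult del: of_real_mult of_real_minus times_divide_eq_left)
qed measurable

lemma has_vector_derivative_inversion_integral:
  "(inversion_integral has_vector_derivative fourier (char M) x) (at x)"
  unfolding inversion_integral_def fourier_def
proof (rule has_vector_derivative_integral_param[where w = "\<lambda>t. norm (char M t)"])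
  show "integrable lborel (\<lambda>t. (1 - iexp (- (t * x))) / (\<i> * t) * char M t)" for x
    using integrable_inversion_kernel[of 0 x] by simp
  show "AE t in lborel. \<forall>x. ((\<lambda>x. (1 - iexp (- (t * x))) / (\<i> * t) * char M t) has_vector_derivative
      iexp (- (t * x)) * char M t) (at x)"
    using AE_lborel_singleton[of 0]
  proof eventually_elim
    case (elim t)
    have "((\<lambda>x. iexp (- (t * x))) has_vector_derivative - (\<i> * t) * iexp (- (t * x))) (at x)" for x
      unfolding has_vector_derivative_complex_iff
      by (auto simp: Re_exp Im_exp intro!: derivative_eq_intros)
    then have "((\<lambda>x. (1 - iexp (- (t * x))) * (char M t / (\<i> * t))) has_vector_derivative
        (0 - (- (\<i> * t) * iexp (- (t * x)))) * (char M t / (\<i> * t))) (at x)" for x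
      by (intro has_vector_derivative_mult_left has_vector_derivative_diff has_vector_derivative_const)
    then show ?case using elim by (simp add: field_simps)
  qed
qed (use int_char in \<open>auto simp: norm_mult\<close>)

text \<open>Levy's inversion formula is a limit of truncated integrals; integrability of the characteristic
function turns it into an integral over the whole line.\<close>

lemma measure_Ioc_eq_inversion_integral:
  assumes "a \<le> b" "measure M {a} = 0" "measure M {b} = 0"
  shows "2 * pi * measure M {a<..b} = Re (inversion_integral b - inversion_integral a)"
proof -
  let ?k = "\<lambda>t. (iexp (- (t * a)) - iexp (- (t * b))) / (\<i> * t) * char M t"
  have "(\<lambda>n. CLBINT t=-(real n)..real n. ?k t) \<longlonglongrightarrow> (CLINT t|lborel. ?k t)"
  proof -
    have "(\<lambda>n. CLINT t|lborel. indicator {-(real n)<..<real n} t *\<^sub>R ?k t) \<longlonglongrightarrow> (CLINT t|lborel. ?k t)"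
    proof (rule integral_dominated_convergence[where w = "\<lambda>t. norm (?k t)"])
      show "integrable lborel (\<lambda>t. norm (?k t))"
        by (intro integrable_norm integrable_inversion_kernel)
      show "AE t in lborel. (\<lambda>n. indicator {-(real n)<..<real n} t *\<^sub>R ?k t) \<longlonglongrightarrow> ?k t"
      proof (rule AE_I2)
        fix t
        obtain N where "\<bar>t\<bar> < real N" using reals_Archimedean2 by blast
        then have "eventually (\<lambda>n. indicator {-(real n)<..<real n} t *\<^sub>R ?k t = ?k t) sequentially"
          by (intro eventually_sequentiallyI[of N]) (auto split: split_indicator)
        then show "(\<lambda>n. indicator {-(real n)<..<real n} t *\<^sub>R ?k t) \<longlonglongrightarrow> ?k t"
          by (rule tendsto_eventually)
      qed
    qed (auto split: split_indicator)
    then show ?thesis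
      by (simp add: interval_lebesgue_integral_def set_lebesgue_integral_def)
  qed
  then have "(\<lambda>n. 1 / (2 * pi) * (CLBINT t=-(real n)..real n. ?k t))
      \<longlonglongrightarrow> 1 / (2 * pi) * (CLINT t|lborel. ?k t)"
    by (intro tendsto_intros)
  then have "of_real (measure M {a<..b}) = 1 / (2 * pi) * (CLINT t|lborel. ?k t)"
    using Levy_Inversion[OF assms] by (intro LIMSEQ_unique) simp_all
  then have "of_real (2 * pi * measure M {a<..b}) = (CLINT t|lborel. ?k t)"
    by (simp add: field_simps)
  also have "\<dots> = (CLINT t|lborel. (1 - iexp (- (t * b))) / (\<i> * t) * char M t
      - (1 - iexp (- (t * a))) / (\<i> * t) * char M t)"
    by (intro Bochner_Integration.integral_cong) (auto simp: diff_divide_distrib algebra_simps)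
  also have "\<dots> = inversion_integral b - inversion_integral a"
    using integrable_inversion_kernel[of 0] unfolding inversion_integral_def
    by (intro Bochner_Integration.integral_diff) simp_all
  finally show ?thesis by (metis Re_complex_of_real)
qed

text \<open>The inversion formula only reaches endpoints that are not atoms. The atoms are countable, so every
point is a limit from the right of such endpoints, and both sides are continuous from the right.\<close>

lemma cdf_eq_inversion_integral:
  "cdf M y - cdf M x = (Re (inversion_integral y) - Re (inversion_integral x)) / (2 * pi)"
proof -
  define A where "A = {x. measure M {x} > 0}"
  define D where "D x = cdf M x - Re (inversion_integral x) / (2 * pi)" for x
  have D_le: "D b = D a" if "a \<notin> A" "b \<notin> A" "a \<le> b" for a b
  proof -
    have "measure M {a} = 0" "measure M {b} = 0"
      using that by (auto simp: A_def not_less intro: antisym)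
    then have "2 * pi * measure M {a<..b} = Re (inversion_integral b) - Re (inversion_integral a)"
      using measure_Ioc_eq_inversion_integral \<open>a \<le> b\<close> by simp
    moreover have "measure M {a<..b} = cdf M b - cdf M a"
      using emeasure_Ioc[OF \<open>a \<le> b\<close>] cdf_nondecreasing[OF \<open>a \<le> b\<close>]
      by (simp add: emeasure_eq_measure)
    ultimately show ?thesis by (simp add: D_def field_simps)
  qed
  then have D_eq: "D b = D a" if "a \<notin> A" "b \<notin> A" for a b
    using that by (metis linear)
  have "countable A" using countable_atoms by (simp add: A_def)
  then have "A \<noteq> UNIV"
    using uncountable_UNIV_real by metis
  then obtain z where z: "z \<notin> A" by auto
  have D_const: "D x = D z" for x
  proof (rule ccontr)
    assume ne: "D x \<noteq> D z"
    have "isCont inversion_integral x"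
      using has_vector_derivative_inversion_integral has_vector_derivative_continuous by blast
    then have "(inversion_integral \<longlongrightarrow> inversion_integral x) (at_right x)"
      by (simp add: isCont_def filterlim_at_split)
    moreover have "(cdf M \<longlongrightarrow> cdf M x) (at_right x)"
      using cdf_is_right_cont[of x] by (simp add: continuous_within)
    ultimately have "((\<lambda>x. cdf M x - Re (inversion_integral x) / (2 * pi)) \<longlongrightarrow> D x) (at_right x)"
      unfolding D_def by (intro tendsto_intros) auto
    then have "(D \<longlongrightarrow> D x) (at_right x)"
      by (simp add: D_def[abs_def])
    then have "eventually (\<lambda>y. D y \<noteq> D z) (at_right x)"
      using ne by (rule tendsto_imp_eventually_ne)
    then obtain b where b: "b > x" "\<And>y. y > x \<Longrightarrow> y < b \<Longrightarrow> D y \<noteq> D z"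
      by (auto simp: eventually_at_right_field)
    have "{x<..<b} \<subseteq> A"
    proof
      fix y assume "y \<in> {x<..<b}"
      then show "y \<in> A"
        using b(2)[of y] D_eq[OF z, of y] by auto
    qed
    then show False
      using \<open>countable A\<close> countable_subset uncountable_open_interval b(1) by blast
  qed
  have "D y = D x" using D_const[of x] D_const[of y] by simp
  then show ?thesis by (simp add: D_def diff_divide_distrib)
qed

lemma has_real_derivative_cdf:
  "(cdf M has_real_derivative 1 / (2 * pi) * Re (fourier (char M) x)) (at x)"
proof -
  have "((\<lambda>x. cdf M 0 + 1 / (2 * pi) * (Re (inversion_integral x) - Re (inversion_integral 0)))
      has_real_derivative 0 + 1 / (2 * pi) * (Re (fourier (char M) x) - 0)) (at x)"
    using has_vector_derivative_inversion_integral[of x]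
    by (intro DERIV_add DERIV_const DERIV_cmult DERIV_diff) (auto simp: has_vector_derivative_complex_iff)
  moreover have "cdf M = (\<lambda>x. cdf M 0 + 1 / (2 * pi) * (Re (inversion_integral x) - Re (inversion_integral 0)))"
  proof
    fix y
    show "cdf M y = cdf M 0 + 1 / (2 * pi) * (Re (inversion_integral y) - Re (inversion_integral 0))"
      using cdf_eq_inversion_integral[of y 0] by simp
  qed
  ultimately show ?thesis by simp
qed

text \<open>Positivity cannot be read off the Fourier integral; it holds because the integral is the derivative
of a monotone function.\<close>

lemma inverse_fourier_char_nonneg: "0 \<le> 1 / (2 * pi) * Re (fourier (char M) x)"
  by (rule mono_on_imp_deriv_nonneg[OF _ has_real_derivative_cdf, of UNIV])
     (auto simp: mono_on_def cdf_nondecreasing)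

lemma eq_density_inverse_fourier_char:
  "M = density lborel (\<lambda>x. ennreal (1 / (2 * pi) * Re (fourier (char M) x)))"
    (is "M = density lborel ?g")
proof (rule measure_eqI_generator_eq[where \<Omega>=UNIV])
  have g_borel [measurable]: "(\<lambda>x. 1 / (2 * pi) * Re (fourier (char M) x)) \<in> borel_measurable borel"
    unfolding fourier_def by measurable
  fix X assume "X \<in> range (\<lambda>(a, b). {a<..b::real})"
  then obtain a b where X: "X = {a<..b}" by auto
  show "emeasure M X = emeasure (density lborel ?g) X"
  proof (cases "a \<le> b")
    case True
    have "emeasure (density lborel ?g) X = (\<integral>\<^sup>+x. ?g x * indicator {a<..b} x \<partial>lborel)"
      unfolding X by (rule emeasure_density) measurable
    also have "\<dots> = (\<integral>\<^sup>+x. ?g x * indicator {a..b} x \<partial>lborel)"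
      using AE_lborel_singleton[of a]
      by (intro nn_integral_cong_AE) (auto elim!: eventually_mono split: split_indicator)
    also have "\<dots> = cdf M b - cdf M a"
      by (rule nn_integral_FTC_Icc[OF _ has_real_derivative_cdf inverse_fourier_char_nonneg])
        (simp_all only: g_borel True)
    finally show ?thesis
      using emeasure_Ioc[OF True] X by simp
  qed (simp add: X)
next
  show "(\<Union>i. {- real (i::nat)<..real i}) = UNIV"
    by (rule UN_Ioc_eq_UNIV)
qed (auto simp: borel_sigma_sets_Ioc Int_stable_def emeasure_eq_measure)

end

text \<open>Rapid decrease makes each \<open>(- \<i> * t) ^ k * char M t\<close> a continuous function of quadratic decay. Hence
the inverse transform of the characteristic function may be differentiated under the integral any
number of times, and the Riemann--Lebesgue lemma applies to every derivative.\<close>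

theorem smooth_density_if_char_rapidly_decreasing:
  assumes decay: "\<And>k. \<exists>C. \<forall>t. \<bar>t\<bar> ^ k * norm (char M t) \<le> C"
  shows "\<exists>g :: real \<Rightarrow> real. (\<forall>x. 0 \<le> g x) \<and> M = density lborel (\<lambda>x. ennreal (g x)) \<and>
    (\<forall>k x. ((deriv ^^ k) g) differentiable (at x)) \<and> (\<forall>k. ((deriv ^^ k) g \<longlongrightarrow> 0) at_infinity)"
proof -
  define h where "h k t = (- \<i> * complex_of_real t) ^ k * char M t" for k t
  have cont: "continuous_on UNIV (h k)" for k
    unfolding h_def
    by (intro continuous_intros continuous_at_imp_continuous_on ballI isCont_char)
  have quadratic: "\<exists>C. \<forall>t. norm (h k t) \<le> C / (1 + t\<^sup>2)" for k
  proof -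
    obtain C1 C2 where C: "\<And>t. \<bar>t\<bar> ^ k * norm (char M t) \<le> C1" "\<And>t. \<bar>t\<bar> ^ (k + 2) * norm (char M t) \<le> C2"
      using decay by meson
    have "norm (h k t) \<le> (C1 + C2) / (1 + t\<^sup>2)" for t
    proof -
      have "norm (h k t) * (1 + t\<^sup>2) = \<bar>t\<bar> ^ k * norm (char M t) + \<bar>t\<bar> ^ (k + 2) * norm (char M t)"
        by (simp add: h_def norm_mult norm_power power_add power2_eq_square algebra_simps)
      also have "\<dots> \<le> C1 + C2" by (intro add_mono C)
      finally show ?thesis by (simp add: pos_le_divide_eq add_pos_nonneg)
    qed
    then show ?thesis by blast
  qed
  have int: "integrable lborel (h k)" for k
    using quadratic integrable_if_quadratic_decay borel_measurable_continuous_onI[OF cont] by blast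
  have lim: "(fourier (h k) \<longlongrightarrow> 0) at_infinity" for k
    using quadratic fourier_tendsto_zero[OF cont] by blast
  have int_char: "integrable lborel (char M)"
  proof -
    have "h 0 = char M" by (rule ext) (simp add: h_def)
    then show ?thesis using int[of 0] by simp
  qed
  let ?g = "\<lambda>x. 1 / (2 * pi) * Re (fourier (char M) x)"
  note derivs = deriv_funpow_fourier[OF char_measurable int[unfolded h_def], folded h_def]
  show ?thesis
  proof (intro exI conjI allI)
    show "0 \<le> ?g x" for x
      by (rule inverse_fourier_char_nonneg[OF int_char])
    show "M = density lborel (\<lambda>x. ennreal (?g x))"
      by (rule eq_density_inverse_fourier_char[OF int_char])
    show "((deriv ^^ k) ?g) differentiable (at x)" for k x
      unfolding derivs(1) using derivs(2) real_differentiable_def by blast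
    show "((deriv ^^ k) ?g \<longlongrightarrow> 0) at_infinity" for k
      unfolding derivs(1)
      using tendsto_mult[OF tendsto_const[of "1 / (2 * pi)"] tendsto_Re[OF lim[of k]]] by simp
  qed
qed

end

section \<open>Growth of the Levy exponent\<close>

text \<open>
The Taylor estimate of second order covers the small jumps, for which the compensator is present; the
large jumps are bounded trivially. So a Levy measure integrates the Levy--Khintchine integrand.
\<close>

lemma levy_integrand_bound:
  "cmod (iexp (t * x) - 1 - \<i> * complex_of_real (t * x * indicator {-1..1} x))
    \<le> (2 + t\<^sup>2) * min 1 (x\<^sup>2)"
proof (cases "\<bar>x\<bar> \<le> 1")
  case True
  have "cmod (iexp (t * x) - (1 + \<i> * complex_of_real (t * x))) \<le> (t * x)\<^sup>2 / 2"
    using iexp_approx1[of "t * x" 1] by (simp add: eval_nat_numeral)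
  also have "\<dots> \<le> (2 + t\<^sup>2) * x\<^sup>2"
    by (simp add: power_mult_distrib field_simps)
  finally show ?thesis
    using True by (simp add: diff_diff_eq abs_le_iff abs_square_le_1 min_absorb2)
next
  case False
  have "cmod (iexp (t * x) - 1) \<le> 2"
    using norm_triangle_ineq4[of "iexp (t * x)" 1] by (simp del: of_real_mult)
  also have "2 \<le> (2 + t\<^sup>2) * min 1 (x\<^sup>2)"
    using False abs_square_le_1[of x] by (simp add: min_absorb1)
  finally have "cmod (iexp (t * x) - 1) \<le> (2 + t\<^sup>2) * min 1 (x\<^sup>2)" .
  moreover have "indicator {-1..1} x = (0::real)"
    using False by (auto simp: indicator_def)
  ultimately show ?thesis by (simp del: of_real_mult)
qed

lemma integrable_levy_integrand:
  assumes "levy_measure \<nu>"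
  shows "integrable \<nu> (\<lambda>x. iexp (t * x) - 1 - \<i> * complex_of_real (t * x * indicator {-1..1} x))"
proof (rule Bochner_Integration.integrable_bound)
  have [measurable_cong]: "sets \<nu> = sets borel" using assms by (simp add: levy_measure_def)
  have "integrable \<nu> (\<lambda>x. min 1 (x\<^sup>2))"
    using assms by (intro integrableI_nonneg) (auto simp: levy_measure_def)
  then show "integrable \<nu> (\<lambda>x. (2 + t\<^sup>2) * min 1 (x\<^sup>2))" by simp
  show "AE x in \<nu>. norm (iexp (t * x) - 1 - \<i> * complex_of_real (t * x * indicator {-1..1} x))
      \<le> norm ((2 + t\<^sup>2) * min 1 (x\<^sup>2))"
    unfolding real_norm_def
    by (intro AE_I2 order_trans[OF levy_integrand_bound abs_ge_self])
  show "(\<lambda>x. iexp (t * x) - 1 - \<i> * complex_of_real (t * x * indicator {-1..1} x)) \<in> borel_measurable \<nu>"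
    by measurable
qed

lemma integrable_one_minus_cos:
  assumes "levy_measure \<nu>"
  shows "integrable \<nu> (\<lambda>x. 1 - cos (t * x))"
proof -
  have "integrable \<nu> (\<lambda>x. - Re (iexp (t * x) - 1 - \<i> * complex_of_real (t * x * indicator {-1..1} x)))"
    by (intro integrable_minus integrable_Re integrable_levy_integrand assms)
  then show ?thesis by (simp add: Re_exp)
qed

lemma Re_levy_exponent:
  assumes "levy_measure \<nu>"
  shows "Re (levy_exponent a b \<nu> t) = - (a * t\<^sup>2 / 2) - (LINT x|\<nu>. 1 - cos (t * x))"
proof -
  have "Re (CLINT x|\<nu>. iexp (t * x) - 1 - \<i> * complex_of_real (t * x * indicator {-1..1} x))
      = (LINT x|\<nu>. - (1 - cos (t * x)))"
    by (subst integral_Re[symmetric, OF integrable_levy_integrand[OF assms]]) (simp add: Re_exp)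
  then show ?thesis
    by (simp add: levy_exponent_def del: minus_diff_eq of_real_mult)
qed

text \<open>The bound is used on the window \<open>1 / 2 \<le> \<bar>u\<bar> \<le> 1\<close> only, which keeps the argument away from the
zeros of \<open>1 - cos\<close> at \<open>0\<close> and \<open>2 * pi\<close>.\<close>

lemma one_minus_cos_ge:
  fixes u :: real
  assumes "1 / 2 \<le> \<bar>u\<bar>" "\<bar>u\<bar> \<le> 1"
  shows "1 - cos (1 / 2) \<le> 1 - cos u"
proof -
  have "cos \<bar>u\<bar> \<le> cos (1 / 2)"
    using assms pi_gt3 by (intro cos_monotone_0_pi_le) auto
  then show ?thesis by simp
qed

lemma one_minus_cos_half_pos: "0 < 1 - cos (1 / 2 :: real)"
  using cos_monotone_0_pi[of 0 "1 / 2"] pi_gt3 by simp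

text \<open>The integrand \<open>p x * (1 - cos (t * x))\<close> is nonnegative, so its integral over a single window of
arguments \<open>t * x\<close> of moderate size already is a lower bound.\<close>

lemma integral_one_minus_cos_ge:
  fixes p :: "real \<Rightarrow> real"
  assumes levy: "levy_measure (density lborel (\<lambda>x. ennreal (p x)))"
    and [measurable]: "p \<in> borel_measurable borel" and p_nonneg: "\<And>x. 0 \<le> p x"
    and "lo \<le> hi" "0 \<le> q"
    and u: "\<And>x. x \<in> {lo..hi} \<Longrightarrow> 1 / 2 \<le> \<bar>t * x\<bar> \<and> \<bar>t * x\<bar> \<le> 1"
    and q: "\<And>x. x \<in> {lo..hi} \<Longrightarrow> q \<le> p x"
  shows "q * (1 - cos (1 / 2)) * (hi - lo)
    \<le> (LINT x|density lborel (\<lambda>x. ennreal (p x)). 1 - cos (t * x))"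
proof -
  let ?q = "q * (1 - cos (1 / 2))"
  have "?q * (hi - lo) = (LINT x|lborel. ?q * indicator {lo..hi} x)"
    using \<open>lo \<le> hi\<close> by simp
  also have "\<dots> \<le> (LINT x|lborel. p x * (1 - cos (t * x)))"
  proof (rule integral_mono)
    show "integrable lborel (\<lambda>x. p x * (1 - cos (t * x)))"
      using integrable_one_minus_cos[OF levy, of t] p_nonneg by (simp add: integrable_real_density)
    show "integrable lborel (\<lambda>x. ?q * indicator {lo..hi} x)"
      by (intro integrable_mult_right integrable_real_indicator) (simp_all add: \<open>lo \<le> hi\<close>)
    show "?q * indicator {lo..hi} x \<le> p x * (1 - cos (t * x))" for x
    proof (cases "x \<in> {lo..hi}")
      case True
      then have "?q \<le> p x * (1 - cos (t * x))"
        using u q one_minus_cos_ge one_minus_cos_half_pos p_nonneg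
        by (intro mult_mono) auto
      then show ?thesis using True by simp
    qed (simp add: p_nonneg)
  qed
  also have "\<dots> = (LINT x|density lborel (\<lambda>x. ennreal (p x)). 1 - cos (t * x))"
    using p_nonneg by (simp add: integral_real_density)
  finally show ?thesis .
qed

text \<open>A Levy density at least of order \<open>y powr - (\<alpha> + 1)\<close> near the origin, on one side, makes the exponent
at least of order \<open>\<bar>t\<bar> powr \<alpha>\<close>: the jumps of size between \<open>1 / (2 * \<bar>t\<bar>)\<close> and \<open>1 / \<bar>t\<bar>\<close> are enough,
since there the density is at least of order \<open>\<bar>t\<bar> powr (\<alpha> + 1)\<close> on an interval of length
\<open>1 / (2 * \<bar>t\<bar>)\<close>. The sign \<open>s\<close> selects the side.\<close>

lemma integral_one_minus_cos_ge_powr: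
  fixes p :: "real \<Rightarrow> real"
  assumes levy: "levy_measure (density lborel (\<lambda>x. ennreal (p x)))"
    and p_borel: "p \<in> borel_measurable borel" and p_nonneg: "\<And>x. 0 \<le> p x"
    and "0 < c" "0 < \<alpha>" and s: "s \<in> {-1, 1}"
    and p: "\<And>y. 0 < y \<Longrightarrow> y \<le> 1 \<Longrightarrow> c / y powr (\<alpha> + 1) \<le> p (s * y)"
    and t: "1 \<le> \<bar>t\<bar>"
  shows "c * (1 - cos (1 / 2)) / 2 * \<bar>t\<bar> powr \<alpha>
    \<le> (LINT x|density lborel (\<lambda>x. ennreal (p x)). 1 - cos (t * x))"
proof -
  define r where "r = 1 / \<bar>t\<bar>"
  have r: "0 < r" "r \<le> 1" "\<bar>t\<bar> * r = 1" using t by (auto simp: r_def)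
  let ?q = "c * \<bar>t\<bar> powr (\<alpha> + 1)"
  have near: "1 / 2 \<le> \<bar>t * x\<bar> \<and> \<bar>t * x\<bar> \<le> 1 \<and> ?q \<le> p x"
    if y: "x = s * y" "r / 2 \<le> y" "y \<le> r" for x y
  proof -
    have "0 < y" using r y by simp
    have "\<bar>t\<bar> * (r / 2) \<le> \<bar>t\<bar> * y" "\<bar>t\<bar> * y \<le> \<bar>t\<bar> * r"
      using y by (intro mult_left_mono; simp)+
    then have ty: "1 / 2 \<le> \<bar>t\<bar> * y" "\<bar>t\<bar> * y \<le> 1" using r by auto
    have abs: "\<bar>t * x\<bar> = \<bar>t\<bar> * y" using s y \<open>0 < y\<close> by (auto simp: abs_mult)
    have "\<bar>t\<bar> powr (\<alpha> + 1) * y powr (\<alpha> + 1) = (\<bar>t\<bar> * y) powr (\<alpha> + 1)"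
      using \<open>0 < y\<close> by (simp add: powr_mult)
    also have "\<dots> \<le> 1"
      using ty \<open>0 < \<alpha>\<close> by (intro powr_le1) auto
    finally have "?q * y powr (\<alpha> + 1) \<le> c"
      using \<open>0 < c\<close> mult_left_mono[of _ 1 c] by (simp add: mult.assoc)
    then have "?q \<le> c / y powr (\<alpha> + 1)"
      using \<open>0 < y\<close> by (simp add: pos_le_divide_eq)
    also have "\<dots> \<le> p x" using p[of y] y r \<open>0 < y\<close> by simp
    finally show ?thesis using ty abs by simp
  qed
  have "\<exists>lo hi. hi - lo = r / 2 \<and> (\<forall>x\<in>{lo..hi}. \<exists>y. x = s * y \<and> r / 2 \<le> y \<and> y \<le> r)"
  proof (cases "s = 1")
    case True
    then show ?thesis
      by (intro exI[of _ "r / 2"] exI[of _ r]) auto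
  next
    case False
    then have "s = -1" using s by simp
    then show ?thesis
      by (intro exI[of _ "- r"] exI[of _ "- (r / 2)"]) (auto intro!: exI[of _ "- _"])
  qed
  then obtain lo hi where I: "hi - lo = r / 2"
    "\<And>x. x \<in> {lo..hi} \<Longrightarrow> \<exists>y. x = s * y \<and> r / 2 \<le> y \<and> y \<le> r"
    by blast
  have "\<bar>t\<bar> powr (\<alpha> + 1) * r = \<bar>t\<bar> powr \<alpha>"
    using t by (simp add: r_def powr_add)
  then have "c * (1 - cos (1 / 2)) / 2 * \<bar>t\<bar> powr \<alpha> = ?q * (1 - cos (1 / 2)) * (hi - lo)"
    unfolding I(1) by (simp add: field_simps)
  also have "\<dots> \<le> (LINT x|density lborel (\<lambda>x. ennreal (p x)). 1 - cos (t * x))"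
    using I near r \<open>0 < c\<close>
    by (intro integral_one_minus_cos_ge levy p_borel p_nonneg) (fastforce+)
  finally show ?thesis .
qed

section \<open>Decay of the characteristic function of a Lamperti stable distribution\<close>

text \<open>With \<open>z = K * y powr \<alpha>\<close>, the inequality \<open>z / n \<le> exp (z / n)\<close> raised to the power \<open>n\<close> shows that
\<open>exp z\<close> dominates \<open>z ^ n\<close>, which dominates \<open>y ^ k\<close> as soon as \<open>n > k / \<alpha>\<close>.\<close>

lemma power_times_exp_minus_powr_le:
  fixes K \<alpha> y :: real
  assumes "0 < K" "0 < \<alpha>"
  shows "\<exists>C. \<forall>y\<ge>1. y ^ k * exp (- (K * y powr \<alpha>)) \<le> C"
proof -
  obtain n :: nat where n: "real k / \<alpha> < real n" using reals_Archimedean2 by blast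
  then have "0 < n" using assms by (cases n) (auto simp: divide_less_0_iff)
  have "y ^ k * exp (- (K * y powr \<alpha>)) \<le> (real n / K) ^ n" if "1 \<le> y" for y :: real
  proof -
    let ?z = "K * y powr \<alpha>"
    have "real k \<le> \<alpha> * real n"
      using n assms by (simp add: field_simps)
    have "y ^ k = y powr real k" using that by (simp add: powr_realpow)
    also have "\<dots> \<le> y powr (\<alpha> * real n)"
      using that \<open>real k \<le> \<alpha> * real n\<close> by (intro powr_mono) auto
    also have "\<dots> = (y powr \<alpha>) ^ n"
      using that by (simp add: powr_powr[symmetric] powr_realpow)
    also have "\<dots> = (real n / K) ^ n * (?z / real n) ^ n"
      using assms \<open>0 < n\<close> by (simp add: power_mult_distrib[symmetric])
    also have "\<dots> \<le> (real n / K) ^ n * exp (?z / real n) ^ n"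
    proof (intro mult_left_mono power_mono)
      show "?z / real n \<le> exp (?z / real n)"
        using exp_ge_add_one_self[of "?z / real n"] by linarith
    qed (use assms in simp_all)
    also have "exp (?z / real n) ^ n = exp ?z"
      using \<open>0 < n\<close> by (simp add: exp_of_nat_mult[symmetric])
    finally have "y ^ k \<le> (real n / K) ^ n * exp ?z" .
    then show ?thesis
      by (simp add: exp_minus field_simps)
  qed
  then show ?thesis by blast
qed

text \<open>Near the origin \<open>exp y - 1\<close> is at most \<open>2 * y\<close>, so the Lamperti density has the singularity of an
\<open>\<alpha>\<close>-stable Levy density there; the exponential tilt only changes the constant.\<close>

lemma lamperti_profile_ge:
  fixes m \<beta> a y :: real
  assumes "0 \<le> m" "0 < a" "0 < y" "y \<le> 1"
  shows "m * exp (- \<bar>\<beta>\<bar>) / 2 powr a / y powr a \<le> m * exp (\<beta> * y) / (exp y - 1) powr a"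
proof -
  have "\<bar>\<beta> * y\<bar> \<le> \<bar>\<beta>\<bar>"
    using assms by (simp add: abs_mult mult_left_le)
  then have "- \<bar>\<beta>\<bar> \<le> \<beta> * y" by linarith
  have "exp y \<le> 1 + y + y\<^sup>2" using assms by (intro exp_bound) auto
  also have "y\<^sup>2 \<le> y" using assms by (simp add: power2_eq_square mult_left_le)
  finally have "(exp y - 1) powr a \<le> (2 * y) powr a"
    using assms by (intro powr_mono2) auto
  then have "(exp y - 1) powr a \<le> 2 powr a * y powr a"
    using assms by (simp add: powr_mult)
  then have "m * exp (- \<bar>\<beta>\<bar>) / (2 powr a * y powr a) \<le> m * exp (\<beta> * y) / (exp y - 1) powr a"
    using assms \<open>- \<bar>\<beta>\<bar> \<le> \<beta> * y\<close> by (intro frac_le mult_left_mono) auto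
  then show ?thesis by simp
qed

text \<open>At least one of the two half-lines carries jumps, because \<open>\<sigma>\<close> is not zero, and the singularity on
that side alone gives the decay.\<close>

lemma char_lamperti_stable_le:
  assumes "lamperti_stable \<mu>"
  shows "\<exists>K>0. \<exists>\<alpha>>0. \<forall>t. 1 \<le> \<bar>t\<bar> \<longrightarrow> norm (char \<mu> t) \<le> exp (- (K * \<bar>t\<bar> powr \<alpha>))"
proof -
  obtain \<alpha> \<sigma> f b where \<alpha>: "0 < \<alpha>" and fin: "finite_measure \<sigma>"
    and \<sigma>: "sets \<sigma> = Pow {-1, 1}" "emeasure \<sigma> {-1, 1} \<noteq> 0"
    and triplet: "has_levy_triplet \<mu> 0 b (lamperti_levy_measure \<alpha> \<sigma> f)"
    using assms unfolding lamperti_stable_def by blast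
  define p where "p = lamperti_levy_density \<alpha> \<sigma> f"
  have levy: "levy_measure (density lborel (\<lambda>x. ennreal (p x)))"
    and char: "\<And>t. char \<mu> t = exp (levy_exponent 0 b (density lborel (\<lambda>x. ennreal (p x))) t)"
    using triplet by (auto simp: has_levy_triplet_def lamperti_levy_measure_def p_def)
  have p_borel: "p \<in> borel_measurable borel"
    unfolding p_def lamperti_levy_density_def[abs_def] by measurable
  have p_nonneg: "0 \<le> p x" for x
    by (simp add: p_def lamperti_levy_density_def)
  interpret finite_measure \<sigma> by (rule fin)
  have "measure \<sigma> {-1, 1} = measure \<sigma> {-1} + measure \<sigma> {1}"
    using finite_measure_Union[of "{-1}" "{1}"] \<sigma>(1) by (simp add: insert_commute)
  moreover have "measure \<sigma> {-1, 1} \<noteq> 0"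
    using \<sigma>(2) by (simp add: emeasure_eq_measure)
  ultimately obtain s where s: "s \<in> {-1, 1}" "0 < measure \<sigma> {s}"
    by (metis add.right_neutral insertCI measure_nonneg order_le_less)
  define c where "c = measure \<sigma> {s} * exp (- \<bar>f s\<bar>) / 2 powr (\<alpha> + 1)"
  have "0 < c" using s by (simp add: c_def)
  have p: "c / y powr (\<alpha> + 1) \<le> p (s * y)" if "0 < y" "y \<le> 1" for y
  proof -
    have "p (s * y) = measure \<sigma> {s} * exp (f s * y) / (exp y - 1) powr (\<alpha> + 1)"
      using s(1) that by (auto simp: p_def lamperti_levy_density_def)
    then show ?thesis
      using lamperti_profile_ge[of "measure \<sigma> {s}" "\<alpha> + 1" y "f s"] that \<alpha> by (simp add: c_def)
  qed
  define K where "K = c * (1 - cos (1 / 2)) / 2"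
  have "0 < K" using \<open>0 < c\<close> one_minus_cos_half_pos by (simp add: K_def)
  have "norm (char \<mu> t) \<le> exp (- (K * \<bar>t\<bar> powr \<alpha>))" if "1 \<le> \<bar>t\<bar>" for t
    using integral_one_minus_cos_ge_powr[OF levy p_borel p_nonneg \<open>0 < c\<close> \<alpha> s(1) p that]
    by (simp add: char Re_levy_exponent[OF levy] K_def)
  with \<open>0 < K\<close> \<alpha> show ?thesis by blast
qed

lemma char_lamperti_stable_rapidly_decreasing:
  assumes "lamperti_stable \<mu>" and "real_distribution \<mu>"
  shows "\<exists>C. \<forall>t. \<bar>t\<bar> ^ k * norm (char \<mu> t) \<le> C"
proof -
  interpret real_distribution \<mu> by fact
  obtain K \<alpha> where K: "0 < K" "0 < \<alpha>"
    and le: "\<And>t. 1 \<le> \<bar>t\<bar> \<Longrightarrow> norm (char \<mu> t) \<le> exp (- (K * \<bar>t\<bar> powr \<alpha>))"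
    using char_lamperti_stable_le[OF assms(1)] by blast
  obtain C where C: "\<And>y. 1 \<le> y \<Longrightarrow> y ^ k * exp (- (K * y powr \<alpha>)) \<le> C"
    using power_times_exp_minus_powr_le[OF K] by blast
  have "\<bar>t\<bar> ^ k * norm (char \<mu> t) \<le> max 1 C" for t
  proof (cases "1 \<le> \<bar>t\<bar>")
    case True
    have "\<bar>t\<bar> ^ k * norm (char \<mu> t) \<le> \<bar>t\<bar> ^ k * exp (- (K * \<bar>t\<bar> powr \<alpha>))"
      using le[OF True] by (intro mult_left_mono) auto
    also have "\<dots> \<le> C" using C[OF True] .
    finally show ?thesis by simp
  next
    case False
    have "\<bar>t\<bar> ^ k * norm (char \<mu> t) \<le> 1 * 1"
      using False cmod_char_le_1 by (intro mult_mono power_le_one) auto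
    then show ?thesis by simp
  qed
  then show ?thesis by blast
qed

section \<open>Density of a Lamperti stable distribution\<close>

theorem proposition3:
  fixes \<mu> :: "real measure"
  assumes "lamperti_stable \<mu>"
  shows "\<exists>g :: real \<Rightarrow> real. (\<forall>x. 0 \<le> g x) \<and> \<mu> = density lborel (\<lambda>x. ennreal (g x)) \<and>
    smooth_real g \<and> (\<forall>k. ((deriv ^^ k) g \<longlongrightarrow> 0) at_infinity)"
proof -
  interpret real_distribution \<mu>
    using assms by (auto simp: lamperti_stable_def has_levy_triplet_def infinitely_divisible_def)
  show ?thesis
    unfolding smooth_real_def
    using char_lamperti_stable_rapidly_decreasing[OF assms real_distribution_axioms]
    by (rule smooth_density_if_char_rapidly_decreasing)
qed

end
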